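(* Let $P,Q$ be integers and let $(U_n(P,Q))_{n\ge 0}$ be the Lucas sequence of the first type. Suppose $P$ is odd with $P \equiv -1 \pmod 4$, $n$ is even, and $Q \equiv 0 \pmod 4$. Then $U_n(P,Q)$ is not a non-zero perfect square, i.e. there is no nonzero integer $m$ with $U_n(P,Q)=m^2$.
   Context: For fixed integers $P,Q$, the Lucas sequence of the first type is defined by $U_0(P,Q)=0$, $U_1(P,Q)=1$, and $U_n(P,Q)=P\cdot U_{n-1}(P,Q)-Q\cdot U_{n-2}(P,Q)$ for $n\ge 2$. *)

theory Defs
  imports Main "HOL-Number_Theory.Cong"
begin

fun lucas_U :: "int \<Rightarrow> int \<Rightarrow> nat \<Rightarrow> int" where
  "lucas_U P Q 0 = 0"
| "lucas_U P Q (Suc 0) = 1"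
| "lucas_U P Q (Suc (Suc n)) = P * lucas_U P Q (Suc n) - Q * lucas_U P Q n"

end

theory Submission
  imports Defs
begin

text \<open>Modulo \<open>4\<close> the sequence \<open>U(P, Q)\<close> agrees with \<open>U(-1, 0)\<close>, whose value at \<open>n > 0\<close> is
  \<open>(-1) ^ (n - 1)\<close>. For even \<open>n > 0\<close> this is \<open>-1\<close>, which is not a square modulo \<open>4\<close>.\<close>

lemma lucas_U_cong:
  assumes "[P = P'] (mod m)" and "[Q = Q'] (mod m)"
  shows "[lucas_U P Q n = lucas_U P' Q' n] (mod m)"
proof (induction n rule: induct_nat_012)
  case (ge2 n)
  then have "[P * lucas_U P Q (Suc n) - Q * lucas_U P Q n =
      P' * lucas_U P' Q' (Suc n) - Q' * lucas_U P' Q' n] (mod m)"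
    by (intro cong_diff cong_mult assms)
  then show ?case by simp
qed simp_all

lemma lucas_U_0_right_Suc: "lucas_U P 0 (Suc n) = P ^ n"
  by (induction n) simp_all

lemma square_mod_4_eq_mod_2:
  fixes a :: "'a::linordered_euclidean_semiring"
  shows "a\<^sup>2 mod 4 = a mod 2"
proof (cases "even a")
  case True
  then obtain b where "a = 2 * b" by (rule evenE)
  then show ?thesis by (simp add: power_mult_distrib)
next
  case False
  then obtain b where b: "a = 2 * b + 1" by (rule oddE)
  then have "a\<^sup>2 = 1 + 4 * (b\<^sup>2 + b)"
    by (simp add: power2_sum power_mult_distrib distrib_left ac_simps)
  then have "a\<^sup>2 mod 4 = 1 mod 4" by (simp only: mod_mult_self2)
  also have "\<dots> = 1" using one_mod_2_pow_eq [of 2] by simp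
  finally show ?thesis using b by simp
qed

theorem theorem3p3:
  fixes P Q :: int and n :: nat
  assumes "odd P" and "[P = -1] (mod 4)" and "even n" and "[Q = 0] (mod 4)"
  shows "\<not> (\<exists>m::int. m \<noteq> 0 \<and> lucas_U P Q n = m\<^sup>2)"
proof (cases n)
  case 0
  then show ?thesis by simp
next
  case (Suc k)
  have "[lucas_U P Q n = lucas_U (-1) 0 n] (mod 4)"
    by (rule lucas_U_cong) fact+
  also have "lucas_U (-1) 0 n = (-1) ^ k"
    unfolding Suc by (rule lucas_U_0_right_Suc)
  also have "\<dots> = -1"
    using \<open>even n\<close> Suc by simp
  finally have U_mod_4: "lucas_U P Q n mod 4 = 3"
    by (simp add: cong_def)
  have "m\<^sup>2 mod 4 \<noteq> 3" for m :: int
    unfolding square_mod_4_eq_mod_2 by presburger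
  with U_mod_4 show ?thesis
    by metis
qed

end
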